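(* Let $F\subset[-1,1]^T$ be a nonempty set of static experts and let $\ell(\hat y,y)$ be convex and $L$-Lipschitz in its first argument. Then the relaxation $$\mathbf{Rel}_T(F\mid y_1,\dots,y_t)=\mathbb E_\epsilon\Big[\sup_{f\in F}\Big\{2L\sum_{i=t+1}^T\epsilon_if[i]-\sum_{i=1}^t\ell(f[i],y_i)\Big\}\Big]$$ is admissible with respect to the randomized prediction strategy that at round $t$ draws fresh i.i.d. Rademacher variables $\epsilon_{t+1},\dots,\epsilon_T$ and predicts $$\hat y_t(\epsilon)=\inf_{f\in F}\Big\{-\sum_{i=t+1}^T\epsilon_if[i]+\frac1{2L}\sum_{i=1}^{t-1}\ell(f[i],y_i)+\frac12f[t]\Big\}-\inf_{f\in F}\Big\{-\sum_{i=t+1}^T\epsilon_if[i]+\frac1{2L}\sum_{i=1}^{t-1}\ell(f[i],y_i)-\frac12f[t]\Big\}.$$ Further, the expected regret of this randomized strategy is bounded as $$\mathbb E[\mathbf{Reg}_T]\le2L\,\mathbb E_\epsilon\Big[\sup_{f\in F}\sum_{t=1}^T\epsilon_tf[t]\Big].$$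
   Context: Protocol (static experts / transductive online learning): on each round $t=1,\dots,T$ the learner makes a (randomized) prediction $\hat y_t\in[-1,1]$, Nature simultaneously chooses the outcome $y_t\in[-1,1]$ (possibly depending on the past), and the learner suffers $\ell(\hat y_t,y_t)$. $f[t]$ is the $t$-th coordinate of $f\in F$. $\mathbf{Reg}_T=\sum_{t=1}^T\ell(\hat y_t,y_t)-\inf_{f\in F}\sum_{t=1}^T\ell(f[t],y_t)$. Admissible with respect to the strategy means: for every $t$ and history, $\sup_{y_t}\{\mathbb E_\epsilon[\ell(\hat y_t(\epsilon),y_t)]+\mathbf{Rel}_T(F\mid y_1,\dots,y_t)\}\le\mathbf{Rel}_T(F\mid y_1,\dots,y_{t-1})$, and $\mathbf{Rel}_T(F\mid y_1,\dots,y_T)\ge-\inf_{f\in F}\sum_{t=1}^T\ell(f[t],y_t)$. *)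

theory Defs
  imports "HOL-Probability.Probability"
begin

text \<open>
  A history of outcomes \<open>y\<^sub>1, \<dots>, y\<^sub>t\<close> is a list \<open>ys\<close> of length \<open>t\<close>, so \<open>y\<^sub>i\<close> is \<open>ys ! (i - 1)\<close> and
  the round to be played after \<open>ys\<close> is \<open>length ys + 1\<close>. An expert is a vector indexed by \<open>1, \<dots>, T\<close>.
  A loss takes the prediction as its first argument and the outcome as its second.

  The real-valued \<open>SUP\<close> and \<open>INF\<close> over experts below are meant for nonempty \<open>F\<close> in \<open>[-1,1]\<^sup>T\<close> and
  losses Lipschitz on \<open>[-1,1]\<close> in the prediction, where all sets concerned are bounded.
\<close>

definition cum_loss :: "(real \<Rightarrow> real \<Rightarrow> real) \<Rightarrow> (nat \<Rightarrow> real) \<Rightarrow> real list \<Rightarrow> real" where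
  "cum_loss loss f ys = (\<Sum>i = 1..length ys. loss (f i) (ys ! (i - 1)))"

definition rademacher_pmf :: "real pmf" where
  "rademacher_pmf = pmf_of_set {-1, 1}"

text \<open>The joint law of i.i.d. Rademacher variables \<open>\<epsilon>\<^bsub>t+1\<^esub>, \<dots>, \<epsilon>\<^sub>T\<close>; other coordinates are \<open>0\<close>.\<close>

definition signs_pmf :: "nat \<Rightarrow> nat \<Rightarrow> (nat \<Rightarrow> real) pmf" where
  "signs_pmf t T = Pi_pmf {t + 1..T} 0 (\<lambda>_. rademacher_pmf)"

text \<open>
  A randomized learner maps the outcomes seen so far to the law of its next prediction, drawn with
  fresh randomness in each round.
\<close>

type_synonym learner = "real list \<Rightarrow> real pmf"

definition valid_learner :: "nat \<Rightarrow> learner \<Rightarrow> bool" where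
  "valid_learner T q \<longleftrightarrow>
     (\<forall>ys. set ys \<subseteq> {-1..1} \<and> length ys < T \<longrightarrow> set_pmf (q ys) \<subseteq> {-1..1})"

text \<open>The supremum and infimum are taken in \<open>ereal\<close>, so no boundedness is presupposed.\<close>

definition admissible ::
  "nat \<Rightarrow> (nat \<Rightarrow> real) set \<Rightarrow> (real \<Rightarrow> real \<Rightarrow> real) \<Rightarrow> (real list \<Rightarrow> real) \<Rightarrow> learner \<Rightarrow> bool" where
  "admissible T F loss Rel q \<longleftrightarrow>
     (\<forall>ys. set ys \<subseteq> {-1..1} \<and> length ys < T \<longrightarrow>
        (SUP y\<in>{-1..1}. ereal (measure_pmf.expectation (q ys) (\<lambda>a. loss a y) + Rel (ys @ [y])))
          \<le> ereal (Rel ys)) \<and>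
     (\<forall>ys. set ys \<subseteq> {-1..1} \<and> length ys = T \<longrightarrow>
        ereal (Rel ys) \<ge> - (INF f\<in>F. ereal (cum_loss loss f ys)))"

text \<open>
  Nature's choice may depend on all past predictions and outcomes and may itself be randomized; given
  the past, it is independent of the learner's current draw. Discrete laws avoid any measurability
  assumption on the loss in \<open>y\<close>; a bound valid for all such strategies, in particular all deterministic
  ones, applies to each fixed value of an arbitrary private random seed of Nature. A play is the list of pairs
  (prediction, outcome).
\<close>

type_synonym nature = "(real \<times> real) list \<Rightarrow> real pmf"

primrec play_pmf :: "learner \<Rightarrow> nature \<Rightarrow> nat \<Rightarrow> (real \<times> real) list pmf" where
  "play_pmf q \<nu> 0 = return_pmf []"
| "play_pmf q \<nu> (Suc n) =
     bind_pmf (play_pmf q \<nu> n) (\<lambda>h.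
     bind_pmf (q (map snd h)) (\<lambda>a.
     bind_pmf (\<nu> h) (\<lambda>y. return_pmf (h @ [(a, y)]))))"

definition regret ::
  "(real \<Rightarrow> real \<Rightarrow> real) \<Rightarrow> (nat \<Rightarrow> real) set \<Rightarrow> (real \<times> real) list \<Rightarrow> real" where
  "regret loss F h =
     (\<Sum>(a, y)\<leftarrow>h. loss a y) - (INF f\<in>F. cum_loss loss f (map snd h))"

definition relaxation ::
  "(real \<Rightarrow> real \<Rightarrow> real) \<Rightarrow> real \<Rightarrow> nat \<Rightarrow> (nat \<Rightarrow> real) set \<Rightarrow> real list \<Rightarrow> real" where
  "relaxation loss L T F ys =
     measure_pmf.expectation (signs_pmf (length ys) T)
       (\<lambda>\<epsilon>. SUP f\<in>F. 2 * L * (\<Sum>i = length ys + 1..T. \<epsilon> i * f i) - cum_loss loss f ys)"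

definition predict ::
  "(real \<Rightarrow> real \<Rightarrow> real) \<Rightarrow> real \<Rightarrow> nat \<Rightarrow> (nat \<Rightarrow> real) set \<Rightarrow> real list \<Rightarrow> (nat \<Rightarrow> real) \<Rightarrow> real" where
  "predict loss L T F ys \<epsilon> = (let t = length ys + 1 in
     (INF f\<in>F. - (\<Sum>i = t + 1..T. \<epsilon> i * f i) + 1 / (2 * L) * cum_loss loss f ys + 1 / 2 * f t)
   - (INF f\<in>F. - (\<Sum>i = t + 1..T. \<epsilon> i * f i) + 1 / (2 * L) * cum_loss loss f ys - 1 / 2 * f t))"

definition random_playout ::
  "(real \<Rightarrow> real \<Rightarrow> real) \<Rightarrow> real \<Rightarrow> nat \<Rightarrow> (nat \<Rightarrow> real) set \<Rightarrow> learner" where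
  "random_playout loss L T F ys =
     map_pmf (predict loss L T F ys) (signs_pmf (length ys + 1) T)"

end

theory Submission
  imports Defs
begin

text \<open>
  Fix a history and the signs of the future rounds, and let \<open>G f\<close> be the resulting signed sum minus
  the past loss of the expert \<open>f\<close>. With \<open>M s = sup\<^sub>f (G f + s f[t])\<close>, the prediction is
  \<open>a = (M L - M (-L)) / (2L)\<close>, which lies in \<open>[-1,1]\<close>. By the Lipschitz property
  \<open>\<ell>(a, y) + G f - \<ell>(f[t], y) \<le> G f + L \<bar>a - f[t]\<bar>\<close>, and the choice of \<open>a\<close> makes the two bounds
  coming from the two signs of \<open>a - f[t]\<close> both equal to \<open>(M L + M (-L)) / 2\<close>. As \<open>M\<close> is convex, this
  is at most \<open>(M (2L) + M (-2L)) / 2\<close>, the average over the sign of round \<open>t\<close>. Taking expectations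
  gives admissibility; hence the learner's loss so far plus the relaxation is a supermartingale along
  any play, and its final value is the regret.
\<close>

section \<open>Real suprema and infima, and the one-round inequality\<close>

lemma INF_uminus_real: "(INF x\<in>A. - g x) = - (SUP x\<in>A. g x :: real)"
  by (simp add: Inf_real_def image_image)

lemma cSUP_mult_left:
  fixes g :: "'a \<Rightarrow> real"
  assumes "A \<noteq> {}" and bdd: "bdd_above (g ` A)" and "c > 0"
  shows "(SUP x\<in>A. c * g x) = c * (SUP x\<in>A. g x)"
proof (rule antisym)
  have le: "c * g x \<le> c * (SUP x\<in>A. g x)" if "x \<in> A" for x
    using \<open>c > 0\<close> that by (simp add: cSUP_upper bdd)
  then show "(SUP x\<in>A. c * g x) \<le> c * (SUP x\<in>A. g x)"
    by (rule cSUP_least[OF assms(1)])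
  have "(SUP x\<in>A. g x) \<le> (SUP x\<in>A. c * g x) / c"
  proof (rule cSUP_least[OF assms(1)])
    fix x assume "x \<in> A"
    moreover have "bdd_above ((\<lambda>x. c * g x) ` A)" using le by (rule bdd_aboveI2)
    ultimately have "c * g x \<le> (SUP x\<in>A. c * g x)" by (rule cSUP_upper)
    then show "g x \<le> (SUP x\<in>A. c * g x) / c"
      using \<open>c > 0\<close> by (simp add: field_simps)
  qed
  then show "c * (SUP x\<in>A. g x) \<le> (SUP x\<in>A. c * g x)"
    using \<open>c > 0\<close> by (simp add: field_simps)
qed

text \<open>One round in abstract form: \<open>x f\<close> is the current advice of the expert,
  \<open>G f\<close> its remaining score, \<open>\<phi>\<close> the loss against a fixed outcome.
  The point \<open>a\<close> does not depend on \<open>\<phi>\<close>, as the learner commits before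
  the outcome is revealed.\<close>

lemma Lipschitz_sup_bound:
  fixes F :: "'a set" and G x :: "'a \<Rightarrow> real" and \<phi> :: "real \<Rightarrow> real" and L B :: real
  defines "M \<equiv> \<lambda>s. SUP f\<in>F. G f + s * x f"
  defines "a \<equiv> (M L - M (- L)) / (2 * L)"
  assumes "F \<noteq> {}" and "L > 0"
    and G: "\<And>f. f \<in> F \<Longrightarrow> \<bar>G f\<bar> \<le> B"
    and x: "\<And>f. f \<in> F \<Longrightarrow> x f \<in> {-1..1}"
  shows "a \<in> {-1..1}"
    and "L-lipschitz_on {-1..1} \<phi> \<Longrightarrow>
      \<phi> a + (SUP f\<in>F. G f - \<phi> (x f)) \<le> (M (2 * L) + M (- (2 * L))) / 2"
proof -
  have abs_x: "\<bar>s * x f\<bar> \<le> \<bar>s\<bar>" if "f \<in> F" for s f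
  proof -
    have "\<bar>x f\<bar> \<le> 1" using x[OF that] by auto
    then show ?thesis by (simp add: abs_mult mult_left_le)
  qed
  have M_upper: "G f + s * x f \<le> M s" if "f \<in> F" for s f
  proof -
    have "G g + s * x g \<le> B + \<bar>s\<bar>" if "g \<in> F" for g
      using G[OF that] abs_x[OF that, of s] by linarith
    then have "bdd_above ((\<lambda>f. G f + s * x f) ` F)" by (intro bdd_aboveI2)
    then show ?thesis unfolding M_def by (intro cSUP_upper that)
  qed
  have M_least: "M s \<le> K" if "\<And>f. f \<in> F \<Longrightarrow> G f + s * x f \<le> K" for s K
    unfolding M_def using \<open>F \<noteq> {}\<close> that by (rule cSUP_least)
  \<comment> \<open>Moving the slope by \<open>2 * L\<close> changes each term by at most
    \<open>2 * L\<close>, because the advice has absolute value at most 1. The two estimates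
    together bound \<open>a\<close> by 1 in absolute value.\<close>
  have "M L \<le> M (- L) + 2 * L"
    using M_upper[of _ "- L"] abs_x[of _ L] \<open>L > 0\<close> by (intro M_least) fastforce
  moreover have "M (- L) \<le> M L + 2 * L"
    using M_upper[of _ L] abs_x[of _ L] \<open>L > 0\<close> by (intro M_least) fastforce
  ultimately show a: "a \<in> {-1..1}"
    using \<open>L > 0\<close> by (auto simp: a_def field_simps)
  have La: "2 * (L * a) = M L - M (- L)" using \<open>L > 0\<close> by (simp add: a_def)
  \<comment> \<open>Convexity of \<open>M\<close>, a supremum of affine functions of the slope, used
    at L = 3/4 (2L) + 1/4 (-2L) and at its mirror image.\<close>
  have "M L \<le> 3 / 4 * M (2 * L) + 1 / 4 * M (- (2 * L))"
    using M_upper[of _ "2 * L"] M_upper[of _ "- (2 * L)"] by (intro M_least) fastforce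
  moreover have "M (- L) \<le> 1 / 4 * M (2 * L) + 3 / 4 * M (- (2 * L))"
    using M_upper[of _ "2 * L"] M_upper[of _ "- (2 * L)"] by (intro M_least) fastforce
  ultimately have conv: "M L + M (- L) \<le> M (2 * L) + M (- (2 * L))" by linarith
  assume lip: "L-lipschitz_on {-1..1} \<phi>"
  \<comment> \<open>The prediction equalizes the two branches of the absolute value.\<close>
  have "(SUP f\<in>F. G f - \<phi> (x f)) \<le> (M L + M (- L)) / 2 - \<phi> a"
  proof (rule cSUP_least[OF \<open>F \<noteq> {}\<close>])
    fix f assume f: "f \<in> F"
    have "\<phi> a - \<phi> (x f) \<le> L * \<bar>a - x f\<bar>"
      using lipschitz_onD[OF lip a x[OF f]] by (simp add: dist_real_def abs_le_iff)
    moreover have "L * \<bar>a - x f\<bar> = L * a - L * x f \<or> L * \<bar>a - x f\<bar> = L * x f - L * a"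
      by (auto simp: abs_if algebra_simps)
    moreover have "G f + L * x f \<le> M L" "G f - L * x f \<le> M (- L)"
      using M_upper[OF f, of L] M_upper[OF f, of "- L"] by simp_all
    ultimately have "G f - \<phi> (x f) \<le> M L - L * a - \<phi> a \<or> G f - \<phi> (x f) \<le> M (- L) + L * a - \<phi> a"
      by linarith
    then show "G f - \<phi> (x f) \<le> (M L + M (- L)) / 2 - \<phi> a"
      using La by (auto simp: field_simps)
  qed
  with conv show "\<phi> a + (SUP f\<in>F. G f - \<phi> (x f)) \<le> (M (2 * L) + M (- (2 * L))) / 2"
    by (simp add: field_simps)
qed

section \<open>Expectations over discrete laws\<close>

text \<open>Tower rule with a bound on the support only, because losses are controlled only for
  predictions and outcomes in [-1,1].\<close>

lemma expectation_bind_pmf_bounded: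
  fixes f :: "'b \<Rightarrow> real"
  assumes "\<And>x. x \<in> set_pmf (bind_pmf p k) \<Longrightarrow> \<bar>f x\<bar> \<le> B"
  shows "measure_pmf.expectation (bind_pmf p k) f =
    measure_pmf.expectation p (\<lambda>x. measure_pmf.expectation (k x) f)"
proof -
  \<comment> \<open>Clipping to [-B, B] changes nothing on the support and supplies the global bound
    that \<open>integral_bind\<close> asks for.\<close>
  define g where "g x = max (- B) (min B (f x))" for x
  have fg: "f x = g x" if "x \<in> set_pmf (bind_pmf p k)" for x
    using assms[OF that] by (auto simp: g_def)
  have "measure_pmf.expectation (bind_pmf p k) f = measure_pmf.expectation (bind_pmf p k) g"
    using fg by (intro integral_cong_AE) (auto simp: AE_measure_pmf_iff)
  also have "\<dots> = measure_pmf.expectation p (\<lambda>x. measure_pmf.expectation (k x) g)"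
    unfolding measure_pmf_bind
  proof (rule integral_bind[where K = "count_space UNIV" and B = "\<bar>B\<bar>" and B' = 1])
    show "(\<lambda>x. measure_pmf (k x)) \<in> measurable (measure_pmf p) (subprob_algebra (count_space UNIV))"
      using measurable_measure_pmf[of k] by simp
  qed (auto simp: g_def measure_pmf.finite_measure measure_pmf.emeasure_space_1[simplified])
  also have "\<dots> = measure_pmf.expectation p (\<lambda>x. measure_pmf.expectation (k x) f)"
    by (intro integral_cong_AE) (auto simp: AE_measure_pmf_iff intro!: integral_cong_AE fg[symmetric] bexI)
  finally show ?thesis .
qed

text \<open>The two bounds serve integrability: a non-integrable function has Bochner integral 0,
  which would break monotonicity.\<close>

lemma expectation_pmf_mono:
  fixes f g :: "'a \<Rightarrow> real"
  assumes "\<And>x. x \<in> set_pmf p \<Longrightarrow> \<bar>f x\<bar> \<le> B" and "\<And>x. x \<in> set_pmf p \<Longrightarrow> \<bar>g x\<bar> \<le> C"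
    and "\<And>x. x \<in> set_pmf p \<Longrightarrow> f x \<le> g x"
  shows "measure_pmf.expectation p f \<le> measure_pmf.expectation p g"
proof (rule integral_mono_AE)
  show "integrable p f"
    using assms(1) by (intro measure_pmf.integrable_const_bound[of _ B]) (auto simp: AE_measure_pmf_iff)
  show "integrable p g"
    using assms(2) by (intro measure_pmf.integrable_const_bound[of _ C]) (auto simp: AE_measure_pmf_iff)
qed (use assms(3) in \<open>auto simp: AE_measure_pmf_iff\<close>)

lemma abs_expectation_pmf_le:
  fixes f :: "'a \<Rightarrow> real"
  assumes "\<And>x. x \<in> set_pmf p \<Longrightarrow> \<bar>f x\<bar> \<le> B"
  shows "\<bar>measure_pmf.expectation p f\<bar> \<le> B"
  using expectation_pmf_mono[of p f B "\<lambda>_. B" B] expectation_pmf_mono[of p "\<lambda>_. - B" B f B] assms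
  by (fastforce simp: abs_le_iff)

section \<open>Rademacher signs\<close>

lemma set_signs_pmf:
  "set_pmf (signs_pmf t T) = PiE_dflt {t + 1..T} 0 (\<lambda>_. {-1, 1})"
  by (simp add: signs_pmf_def rademacher_pmf_def set_Pi_pmf comp_def)

text \<open>Finite support makes every function of the signs integrable, so their expectations can
  be added freely.\<close>

lemma finite_set_signs_pmf: "finite (set_pmf (signs_pmf t T))"
  unfolding set_signs_pmf by (intro finite_PiE_dflt) auto

text \<open>This holds at every index, since the coordinates outside the drawn range take the
  default value 0.\<close>

lemma abs_signs_pmf_le: "\<epsilon> \<in> set_pmf (signs_pmf t T) \<Longrightarrow> \<bar>\<epsilon> i\<bar> \<le> 1"
  unfolding set_signs_pmf PiE_dflt_def by (cases "i \<in> {t + 1..T}") auto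

text \<open>Conditioning on the sign of round \<open>Suc t\<close>, which is a fair coin independent
  of the later signs.\<close>

lemma expectation_signs_pmf_Suc:
  fixes h :: "(nat \<Rightarrow> real) \<Rightarrow> real"
  assumes "t < T"
  shows "measure_pmf.expectation (signs_pmf t T) h =
    measure_pmf.expectation (signs_pmf (Suc t) T)
      (\<lambda>\<epsilon>. (h (\<epsilon>(Suc t := 1)) + h (\<epsilon>(Suc t := - 1))) / 2)"
proof -
  have "{t + 1..T} = insert (Suc t) {Suc t + 1..T}" using assms by auto
  then have eq: "signs_pmf t T = pmf_of_set {-1, 1} \<bind>
      (\<lambda>s. map_pmf (\<lambda>\<epsilon>. \<epsilon>(Suc t := s)) (signs_pmf (Suc t) T))"
    unfolding signs_pmf_def rademacher_pmf_def map_pmf_def by (simp add: Pi_pmf_insert')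
  note int = integrable_measure_pmf_finite[OF finite_set_signs_pmf]
  show ?thesis
    unfolding eq
    by (subst pmf_expectation_bind_pmf_of_set)
      (auto simp: finite_set_signs_pmf Bochner_Integration.integral_add[OF int int] add_divide_distrib)
qed

section \<open>Histories and plays against an adaptive Nature\<close>

lemma cum_loss_snoc:
  "cum_loss loss f (ys @ [y]) = cum_loss loss f ys + loss (f (length ys + 1)) y"
proof -
  have "(\<Sum>i = 1..length ys. loss (f i) ((ys @ [y]) ! (i - 1))) =
      (\<Sum>i = 1..length ys. loss (f i) (ys ! (i - 1)))"
    by (intro sum.cong) (auto simp: nth_append)
  then show ?thesis by (simp add: cum_loss_def nth_append)
qed

lemma set_play_pmf:
  assumes "valid_learner T q" and "\<And>h. set_pmf (\<nu> h) \<subseteq> {-1..1}"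
    and "n \<le> T" and "h \<in> set_pmf (play_pmf q \<nu> n)"
  shows "set h \<subseteq> {-1..1} \<times> {-1..1} \<and> length h = n"
  using assms(3,4)
proof (induction n arbitrary: h)
  case 0
  then show ?case by simp
next
  case (Suc n)
  then obtain h' a y where h: "h = h' @ [(a, y)]" and h': "h' \<in> set_pmf (play_pmf q \<nu> n)"
    and a: "a \<in> set_pmf (q (map snd h'))" and y: "y \<in> set_pmf (\<nu> h')"
    by auto
  have IH: "set h' \<subseteq> {-1..1} \<times> {-1..1}" "length h' = n"
    using Suc.IH[OF _ h'] Suc.prems(1) by auto
  have "set (map snd h') \<subseteq> {-1..1} \<and> length (map snd h') < T"
    using IH Suc.prems(1) by auto
  then have "set_pmf (q (map snd h')) \<subseteq> {-1..1}"
    using assms(1) unfolding valid_learner_def by blast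
  with a have "a \<in> {-1..1}" by blast
  moreover have "y \<in> {-1..1}" using assms(2) y by blast
  ultimately show ?case using IH h by auto
qed

text \<open>Supermartingale argument. Since \<open>step\<close> holds for each fixed outcome, it
  survives averaging over Nature's draw, which is independent of the learner's draw given the past.
  The uniform bound \<open>B\<close> justifies the iterated expectations.\<close>

lemma expectation_play_pmf_le:
  fixes \<Phi> :: "(real \<times> real) list \<Rightarrow> real"
  assumes q: "valid_learner T q" and \<nu>: "\<And>h. set_pmf (\<nu> h) \<subseteq> {-1..1}"
    and bounded: "\<And>h. set h \<subseteq> {-1..1} \<times> {-1..1} \<Longrightarrow> length h \<le> T \<Longrightarrow> \<bar>\<Phi> h\<bar> \<le> B"
    and step: "\<And>h y. set h \<subseteq> {-1..1} \<times> {-1..1} \<Longrightarrow> length h < T \<Longrightarrow> y \<in> {-1..1} \<Longrightarrow>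
      measure_pmf.expectation (q (map snd h)) (\<lambda>a. \<Phi> (h @ [(a, y)])) \<le> \<Phi> h"
    and "n \<le> T"
  shows "measure_pmf.expectation (play_pmf q \<nu> n) \<Phi> \<le> \<Phi> []"
  using \<open>n \<le> T\<close>
proof (induction n)
  case 0
  then show ?case by simp
next
  case (Suc n)
  define k where "k h = bind_pmf (\<nu> h) (\<lambda>y. map_pmf (\<lambda>a. h @ [(a, y)]) (q (map snd h)))" for h
  \<comment> \<open>Exchanging the order of the two independent draws makes the one-step bound apply for each outcome.\<close>
  have play: "play_pmf q \<nu> (Suc n) = bind_pmf (play_pmf q \<nu> n) k"
    unfolding k_def map_pmf_def by (simp add: bind_commute_pmf[of "q _"])
  have bdd: "\<bar>\<Phi> h\<bar> \<le> B" if "h \<in> set_pmf (bind_pmf (play_pmf q \<nu> n) k)" for h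
  proof -
    have "set h \<subseteq> {-1..1} \<times> {-1..1} \<and> length h = Suc n"
      using that unfolding play[symmetric] by (rule set_play_pmf[OF q \<nu> Suc.prems])
    then show ?thesis using Suc.prems by (intro bounded) auto
  qed
  have valid: "set h \<subseteq> {-1..1} \<times> {-1..1} \<and> length h = n" if "h \<in> set_pmf (play_pmf q \<nu> n)" for h
    using set_play_pmf[where \<nu> = \<nu>, OF q \<nu> _ that] Suc.prems by simp
  have bdd_k: "\<bar>\<Phi> h'\<bar> \<le> B" if "h \<in> set_pmf (play_pmf q \<nu> n)" "h' \<in> set_pmf (k h)" for h h'
    using that by (intro bdd) auto
  have k_le: "measure_pmf.expectation (k h) \<Phi> \<le> \<Phi> h" if h: "h \<in> set_pmf (play_pmf q \<nu> n)" for h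
  proof -
    have "measure_pmf.expectation (k h) \<Phi> =
        measure_pmf.expectation (\<nu> h)
          (\<lambda>y. measure_pmf.expectation (q (map snd h)) (\<lambda>a. \<Phi> (h @ [(a, y)])))"
      using bdd_k[OF h] unfolding k_def by (subst expectation_bind_pmf_bounded) auto
    also have "\<dots> \<le> measure_pmf.expectation (\<nu> h) (\<lambda>_. \<Phi> h)"
    proof (rule expectation_pmf_mono[of _ _ B _ "\<bar>\<Phi> h\<bar>"])
      fix y assume y: "y \<in> set_pmf (\<nu> h)"
      show "measure_pmf.expectation (q (map snd h)) (\<lambda>a. \<Phi> (h @ [(a, y)])) \<le> \<Phi> h"
        using valid[OF h] subsetD[OF \<nu> y] Suc.prems by (intro step) auto
      show "\<bar>measure_pmf.expectation (q (map snd h)) (\<lambda>a. \<Phi> (h @ [(a, y)]))\<bar> \<le> B"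
        using y by (intro abs_expectation_pmf_le bdd_k[OF h]) (auto simp: k_def)
    qed simp
    finally show ?thesis by simp
  qed
  have "measure_pmf.expectation (play_pmf q \<nu> (Suc n)) \<Phi> =
      measure_pmf.expectation (play_pmf q \<nu> n) (\<lambda>h. measure_pmf.expectation (k h) \<Phi>)"
    unfolding play by (rule expectation_bind_pmf_bounded[OF bdd])
  also have "\<dots> \<le> measure_pmf.expectation (play_pmf q \<nu> n) \<Phi>"
  proof (rule expectation_pmf_mono[of _ _ B _ B])
    fix h assume h: "h \<in> set_pmf (play_pmf q \<nu> n)"
    show "\<bar>measure_pmf.expectation (k h) \<Phi>\<bar> \<le> B"
      using bdd_k[OF h] by (rule abs_expectation_pmf_le)
    show "\<bar>\<Phi> h\<bar> \<le> B"
      using valid[OF h] Suc.prems by (intro bounded) auto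
  qed (rule k_le)
  also have "\<dots> \<le> \<Phi> []" using Suc by simp
  finally show ?case .
qed

section \<open>Bounds on losses and signed sums of experts\<close>

locale static_experts =
  fixes T :: nat and F :: "(nat \<Rightarrow> real) set"
    and loss :: "real \<Rightarrow> real \<Rightarrow> real" and L :: real
  assumes F_nonempty: "F \<noteq> {}" and F_subset: "F \<subseteq> {1..T} \<rightarrow>\<^sub>E {-1..1}"
    and L_pos: "L > 0"
    and loss_Lipschitz: "\<And>y. y \<in> {-1..1} \<Longrightarrow> L-lipschitz_on {-1..1} (\<lambda>a. loss a y)"
begin

lemma expert_range: "f \<in> F \<Longrightarrow> i \<in> {1..T} \<Longrightarrow> f i \<in> {-1..1}"
  using F_subset by (meson PiE_mem subsetD)

lemma abs_loss_diff_le: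
  assumes "a \<in> {-1..1}" and "b \<in> {-1..1}" and "y \<in> {-1..1}"
  shows "\<bar>loss a y - loss b y\<bar> \<le> 2 * L"
proof -
  have "\<bar>loss a y - loss b y\<bar> \<le> L * \<bar>a - b\<bar>"
    using lipschitz_onD[OF loss_Lipschitz[OF assms(3)] assms(1,2)] by (simp add: dist_real_def)
  also have "\<dots> \<le> L * 2" using assms L_pos by (intro mult_left_mono) auto
  finally show ?thesis by simp
qed

text \<open>Learner and expert face the same outcome in each round, so a round contributes at most
  \<open>2 * L\<close>, however large the losses themselves are.\<close>

lemma abs_loss_minus_cum_loss_le:
  assumes "set h \<subseteq> {-1..1} \<times> {-1..1}" and "length h \<le> T" and f: "f \<in> F"
  shows "\<bar>(\<Sum>(a, y)\<leftarrow>h. loss a y) - cum_loss loss f (map snd h)\<bar> \<le> 2 * L * length h"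
  using assms(1,2)
proof (induction h rule: rev_induct)
  case Nil
  then show ?case by (simp add: cum_loss_def)
next
  case (snoc x h)
  obtain a y where x: "x = (a, y)" by force
  have "\<bar>loss a y - loss (f (length h + 1)) y\<bar> \<le> 2 * L"
    using snoc.prems x expert_range[OF f, of "length h + 1"] by (intro abs_loss_diff_le) auto
  moreover have "\<bar>(\<Sum>(a, y)\<leftarrow>h. loss a y) - cum_loss loss f (map snd h)\<bar> \<le> 2 * L * length h"
    using snoc by auto
  ultimately show ?case by (simp add: x cum_loss_snoc algebra_simps)
qed

lemma abs_cum_loss_diff_le:
  assumes "set ys \<subseteq> {-1..1}" and "length ys \<le> T" and "f \<in> F" and "g \<in> F"
  shows "\<bar>cum_loss loss f ys - cum_loss loss g ys\<bar> \<le> 2 * L * T"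
proof -
  have "\<bar>cum_loss loss f ys - cum_loss loss g ys\<bar> \<le> 2 * L * length ys"
    using assms(1,2)
  proof (induction ys rule: rev_induct)
    case Nil
    then show ?case by (simp add: cum_loss_def)
  next
    case (snoc y ys)
    have "\<bar>loss (f (length ys + 1)) y - loss (g (length ys + 1)) y\<bar> \<le> 2 * L"
      using snoc.prems expert_range[OF assms(3), of "length ys + 1"]
        expert_range[OF assms(4), of "length ys + 1"]
      by (intro abs_loss_diff_le) auto
    then show ?case using snoc by (simp add: cum_loss_snoc algebra_simps)
  qed
  also have "\<dots> \<le> 2 * L * T" using assms(2) L_pos by simp
  finally show ?thesis .
qed

lemma abs_sum_signs_le:
  assumes "\<And>i. \<bar>\<epsilon> i\<bar> \<le> 1" and "f \<in> F"
  shows "\<bar>\<Sum>i = n + 1..T. \<epsilon> i * f i\<bar> \<le> T"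
proof -
  have "\<bar>\<Sum>i = n + 1..T. \<epsilon> i * f i\<bar> \<le> (\<Sum>i = n + 1..T. 1)"
  proof (intro order_trans[OF sum_abs] sum_mono)
    fix i assume "i \<in> {n + 1..T}"
    then have "\<bar>f i\<bar> \<le> 1" using expert_range[OF assms(2), of i] by auto
    then show "\<bar>\<epsilon> i * f i\<bar> \<le> 1" using assms(1)[of i] by (simp add: abs_mult mult_le_one)
  qed
  also have "\<dots> \<le> T" by simp
  finally show ?thesis .
qed

section \<open>Scores and the prediction of the random playout\<close>

text \<open>The first signed round is a parameter separate from the history: the same
  \<open>ys\<close> is scored both with and without the sign of the round about to be
  played.\<close>

definition score :: "(nat \<Rightarrow> real) \<Rightarrow> nat \<Rightarrow> real list \<Rightarrow> (nat \<Rightarrow> real) \<Rightarrow> real" where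
  "score \<epsilon> n ys f = 2 * L * (\<Sum>i = n + 1..T. \<epsilon> i * f i) - cum_loss loss f ys"

text \<open>Adding the loss of a reference expert leaves only a difference of losses, so the bound
  is uniform in the outcomes. The signed sum and this difference contribute \<open>2 * L * T\<close>
  each.\<close>

lemma abs_score_add_cum_loss_le:
  assumes "\<And>i. \<bar>\<epsilon> i\<bar> \<le> 1" and "set ys \<subseteq> {-1..1}" and "length ys \<le> T"
    and "f \<in> F" and "g \<in> F"
  shows "\<bar>score \<epsilon> n ys f + cum_loss loss g ys\<bar> \<le> 4 * L * T"
proof -
  have "\<bar>2 * L * (\<Sum>i = n + 1..T. \<epsilon> i * f i)\<bar> \<le> 2 * L * T"
    using abs_sum_signs_le[where \<epsilon> = \<epsilon> and n = n, OF assms(1,4)] L_pos by (simp add: abs_mult)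
  with abs_cum_loss_diff_le[OF assms(2-5)] show ?thesis
    unfolding score_def by linarith
qed

text \<open>For fixed signs and a fixed history, a bound depending on both is enough to make the
  suprema over experts well behaved.\<close>

lemma abs_score_le:
  assumes "\<And>i. \<bar>\<epsilon> i\<bar> \<le> 1" and "set ys \<subseteq> {-1..1}" and "length ys \<le> T"
  obtains B where "\<And>f. f \<in> F \<Longrightarrow> \<bar>score \<epsilon> n ys f\<bar> \<le> B"
proof -
  obtain g where "g \<in> F" using F_nonempty by blast
  then have "\<bar>score \<epsilon> n ys f\<bar> \<le> 4 * L * T + \<bar>cum_loss loss g ys\<bar>" if "f \<in> F" for f
    using abs_score_add_cum_loss_le[where \<epsilon> = \<epsilon> and n = n, OF assms that \<open>g \<in> F\<close>] by linarith
  then show ?thesis by (rule that)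
qed

lemma relaxation_eq_score:
  "relaxation loss L T F ys =
    measure_pmf.expectation (signs_pmf (length ys) T) (\<lambda>\<epsilon>. SUP f\<in>F. score \<epsilon> (length ys) ys f)"
  by (simp add: relaxation_def score_def)

text \<open>Each infimand is -1/(2L) times a shifted score, so both infima turn into suprema and the
  prediction becomes the point \<open>a\<close> of \<open>Lipschitz_sup_bound\<close>.\<close>

lemma predict_eq:
  assumes "\<And>i. \<bar>\<epsilon> i\<bar> \<le> 1" and "set ys \<subseteq> {-1..1}" and "length ys < T"
  shows "predict loss L T F ys \<epsilon> =
    ((SUP f\<in>F. score \<epsilon> (length ys + 1) ys f + L * f (length ys + 1)) -
     (SUP f\<in>F. score \<epsilon> (length ys + 1) ys f + (- L) * f (length ys + 1))) / (2 * L)"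
proof -
  define t where "t = length ys + 1"
  obtain B where B: "\<And>f. f \<in> F \<Longrightarrow> \<bar>score \<epsilon> t ys f\<bar> \<le> B"
    by (rule abs_score_le[where \<epsilon> = \<epsilon> and n = t, OF assms(1,2) less_imp_le[OF assms(3)]]) blast
  \<comment> \<open>Both infima at once: \<open>s\<close> = -1 gives the first one in
    \<open>predict\<close>, \<open>s\<close> = 1 the second.\<close>
  have INF: "(INF f\<in>F. - (\<Sum>i = t + 1..T. \<epsilon> i * f i) + 1 / (2 * L) * cum_loss loss f ys - s * (1 / 2 * f t)) =
      - (1 / (2 * L) * (SUP f\<in>F. score \<epsilon> t ys f + s * L * f t))" if "\<bar>s\<bar> = 1" for s
  proof -
    have "score \<epsilon> t ys f + s * L * f t \<le> B + L" if "f \<in> F" for f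
    proof -
      have "\<bar>f t\<bar> \<le> 1" using expert_range[OF that, of t] assms(3) by (auto simp: t_def)
      then have "\<bar>s * L * f t\<bar> \<le> L"
        using L_pos \<open>\<bar>s\<bar> = 1\<close> by (simp add: abs_mult)
      with B[OF that] show ?thesis by linarith
    qed
    then have "bdd_above ((\<lambda>f. score \<epsilon> t ys f + s * L * f t) ` F)" by (intro bdd_aboveI2)
    moreover have "- (\<Sum>i = t + 1..T. \<epsilon> i * f i) + 1 / (2 * L) * cum_loss loss f ys - s * (1 / 2 * f t) =
        - (1 / (2 * L) * (score \<epsilon> t ys f + s * L * f t))" for f
      using L_pos by (simp add: score_def field_simps)
    ultimately show ?thesis
      using L_pos cSUP_mult_left[OF F_nonempty, of _ "1 / (2 * L)"] by (simp only: INF_uminus_real) simp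
  qed
  show ?thesis
    using INF[of "- 1"] INF[of 1]
    unfolding predict_def Let_def t_def[symmetric] by (simp add: diff_divide_distrib)
qed

lemma predict_range:
  assumes "\<And>i. \<bar>\<epsilon> i\<bar> \<le> 1" and "set ys \<subseteq> {-1..1}" and "length ys < T"
  shows "predict loss L T F ys \<epsilon> \<in> {-1..1}"
proof -
  obtain B where "\<And>f. f \<in> F \<Longrightarrow> \<bar>score \<epsilon> (length ys + 1) ys f\<bar> \<le> B"
    by (rule abs_score_le[where \<epsilon> = \<epsilon> and n = "length ys + 1", OF assms(1,2) less_imp_le[OF assms(3)]]) blast
  then show ?thesis
    unfolding predict_eq[OF assms] using assms(3)
    by (intro Lipschitz_sup_bound(1) F_nonempty L_pos expert_range) auto
qed

text \<open>The one-round inequality for each fixed draw of the later signs; the right-hand side is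
  the average over the sign of round \<open>t\<close>.\<close>

lemma loss_predict_le:
  assumes "\<And>i. \<bar>\<epsilon> i\<bar> \<le> 1" and "set ys \<subseteq> {-1..1}" and "length ys < T" and "y \<in> {-1..1}"
  defines "t \<equiv> length ys + 1"
  shows "loss (predict loss L T F ys \<epsilon>) y + (SUP f\<in>F. score \<epsilon> t (ys @ [y]) f) \<le>
    ((SUP f\<in>F. score (\<epsilon>(t := 1)) (length ys) ys f) +
     (SUP f\<in>F. score (\<epsilon>(t := - 1)) (length ys) ys f)) / 2"
proof -
  obtain B where B: "\<And>f. f \<in> F \<Longrightarrow> \<bar>score \<epsilon> t ys f\<bar> \<le> B"
    by (rule abs_score_le[where \<epsilon> = \<epsilon> and n = t, OF assms(1,2) less_imp_le[OF assms(3)]]) blast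
  \<comment> \<open>Thus the slopes 2L and -2L in \<open>Lipschitz_sup_bound\<close> are the two
    values of the sign of round \<open>t\<close>.\<close>
  have upd: "score (\<epsilon>(t := s)) (length ys) ys f = score \<epsilon> t ys f + s * (2 * L) * f t" for s f
  proof -
    have "{length ys + 1..T} = insert t {t + 1..T}" using assms(3) by (auto simp: t_def)
    then have "(\<Sum>i = length ys + 1..T. (\<epsilon>(t := s)) i * f i) = s * f t + (\<Sum>i = t + 1..T. \<epsilon> i * f i)"
      by simp
    then show ?thesis by (simp add: score_def algebra_simps)
  qed
  have snoc: "score \<epsilon> t (ys @ [y]) f = score \<epsilon> t ys f - loss (f t) y" for f
    by (simp add: score_def cum_loss_snoc t_def)
  have t: "t \<in> {1..T}" using assms(3) by (simp add: t_def)
  show ?thesis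
    using Lipschitz_sup_bound(2)[OF F_nonempty L_pos B expert_range[OF _ t] loss_Lipschitz[OF assms(4)]]
    unfolding predict_eq[OF assms(1-3)] upd snoc t_def[symmetric] by simp
qed

section \<open>Admissibility\<close>

lemma valid_random_playout: "valid_learner T (random_playout loss L T F)"
  unfolding valid_learner_def random_playout_def
  using predict_range abs_signs_pmf_le by fastforce

lemma finite_set_random_playout: "finite (set_pmf (random_playout loss L T F ys))"
  by (simp add: random_playout_def finite_set_signs_pmf)

text \<open>The signs behind the prediction and those in the relaxation after the round have the
  same law, so by linearity both expectations merge into one, and \<open>loss_predict_le\<close>
  applies to each draw.\<close>

lemma relaxation_step:
  assumes "set ys \<subseteq> {-1..1}" and "length ys < T" and "y \<in> {-1..1}"
  shows "measure_pmf.expectation (random_playout loss L T F ys) (\<lambda>a. loss a y)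
      + relaxation loss L T F (ys @ [y]) \<le> relaxation loss L T F ys"
proof -
  let ?S = "signs_pmf (Suc (length ys)) T"
  note int = integrable_measure_pmf_finite[OF finite_set_signs_pmf]
  have "measure_pmf.expectation (random_playout loss L T F ys) (\<lambda>a. loss a y)
      + relaxation loss L T F (ys @ [y]) =
    measure_pmf.expectation ?S (\<lambda>\<epsilon>. loss (predict loss L T F ys \<epsilon>) y
      + (SUP f\<in>F. score \<epsilon> (Suc (length ys)) (ys @ [y]) f))"
    by (simp add: random_playout_def relaxation_eq_score Bochner_Integration.integral_add[OF int int])
  also have "\<dots> \<le> measure_pmf.expectation ?S
      (\<lambda>\<epsilon>. ((SUP f\<in>F. score (\<epsilon>(Suc (length ys) := 1)) (length ys) ys f) +
     (SUP f\<in>F. score (\<epsilon>(Suc (length ys) := - 1)) (length ys) ys f)) / 2)"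
    using loss_predict_le[OF _ assms] abs_signs_pmf_le
    by (intro integral_mono_AE int) (auto simp: AE_measure_pmf_iff)
  also have "\<dots> = relaxation loss L T F ys"
    unfolding relaxation_eq_score by (rule expectation_signs_pmf_Suc[OF assms(2), symmetric])
  finally show ?thesis .
qed

text \<open>After \<open>T\<close> rounds no sign is left: the law is a point mass and the signed
  sum is empty.\<close>

lemma relaxation_final:
  assumes "length ys = T"
  shows "relaxation loss L T F ys = - (INF f\<in>F. cum_loss loss f ys)"
  using INF_uminus_real[of "\<lambda>f. - cum_loss loss f ys" F]
  by (simp add: relaxation_def assms signs_pmf_def)

lemma admissible_relaxation:
  "admissible T F loss (relaxation loss L T F) (random_playout loss L T F)"
proof -
  have "- (INF f\<in>F. ereal (cum_loss loss f ys)) \<le> ereal (relaxation loss L T F ys)"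
    if ys: "set ys \<subseteq> {-1..1}" "length ys = T" for ys
  proof -
    obtain g where g: "g \<in> F" using F_nonempty by blast
    \<comment> \<open>A lower bound on the losses for this history is needed for the real infimum to
      lie below the extended-real one.\<close>
    have "cum_loss loss g ys - 2 * L * T \<le> cum_loss loss f ys" if "f \<in> F" for f
      using abs_cum_loss_diff_le[OF _ _ that g, of ys] ys by (auto simp: abs_le_iff)
    then have "bdd_below ((\<lambda>f. cum_loss loss f ys) ` F)" by (rule bdd_belowI2)
    then have "ereal (INF f\<in>F. cum_loss loss f ys) \<le> (INF f\<in>F. ereal (cum_loss loss f ys))"
      by (intro INF_greatest) (auto intro: cINF_lower)
    then show ?thesis
      unfolding relaxation_final[OF ys(2)] by (simp add: ereal_uminus_le_reorder flip: uminus_ereal.simps(1))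
  qed
  then show ?thesis
    using relaxation_step by (auto simp: admissible_def intro!: SUP_least)
qed

section \<open>The expected regret\<close>

text \<open>The reference loss is constant in the signs and moves inside the expectation, where the
  score bound holds for every draw.\<close>

lemma abs_relaxation_add_cum_loss_le:
  assumes "set ys \<subseteq> {-1..1}" and "length ys \<le> T" and "g \<in> F"
  shows "\<bar>relaxation loss L T F ys + cum_loss loss g ys\<bar> \<le> 4 * L * T"
proof -
  note int = integrable_measure_pmf_finite[OF finite_set_signs_pmf]
  have "relaxation loss L T F ys + cum_loss loss g ys =
    measure_pmf.expectation (signs_pmf (length ys) T)
      (\<lambda>\<epsilon>. (SUP f\<in>F. score \<epsilon> (length ys) ys f) + cum_loss loss g ys)"
    by (simp add: relaxation_eq_score Bochner_Integration.integral_add[OF int int])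
  also have "\<bar>\<dots>\<bar> \<le> 4 * L * T"
  proof (rule abs_expectation_pmf_le)
    fix \<epsilon> assume "\<epsilon> \<in> set_pmf (signs_pmf (length ys) T)"
    then have bnd: "\<bar>score \<epsilon> (length ys) ys f + cum_loss loss g ys\<bar> \<le> 4 * L * T" if "f \<in> F" for f
      using that assms by (intro abs_score_add_cum_loss_le abs_signs_pmf_le)
    have le: "score \<epsilon> (length ys) ys f \<le> 4 * L * T - cum_loss loss g ys" if "f \<in> F" for f
      using bnd[OF that] by linarith
    then have bdd: "bdd_above (score \<epsilon> (length ys) ys ` F)" by (rule bdd_aboveI2)
    have "(SUP f\<in>F. score \<epsilon> (length ys) ys f) \<le> 4 * L * T - cum_loss loss g ys"
      using F_nonempty le by (rule cSUP_least)
    with bnd[OF assms(3)] cSUP_upper[OF assms(3) bdd]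
    show "\<bar>(SUP f\<in>F. score \<epsilon> (length ys) ys f) + cum_loss loss g ys\<bar> \<le> 4 * L * T"
      by linarith
  qed
  finally show ?thesis .
qed

lemma relaxation_Nil:
  "relaxation loss L T F [] =
    2 * L * measure_pmf.expectation (signs_pmf 0 T) (\<lambda>\<epsilon>. SUP f\<in>F. \<Sum>t = 1..T. \<epsilon> t * f t)"
proof -
  have "(SUP f\<in>F. score \<epsilon> 0 [] f) = 2 * L * (SUP f\<in>F. \<Sum>t = 1..T. \<epsilon> t * f t)"
    if "\<epsilon> \<in> set_pmf (signs_pmf 0 T)" for \<epsilon>
  proof -
    have "(\<Sum>t = 1..T. \<epsilon> t * f t) \<le> T" if "f \<in> F" for f
      using abs_sum_signs_le[where \<epsilon> = \<epsilon> and n = 0, OF abs_signs_pmf_le[OF \<open>\<epsilon> \<in> _\<close>] that]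
      by (simp add: abs_le_iff)
    then have "bdd_above ((\<lambda>f. \<Sum>t = 1..T. \<epsilon> t * f t) ` F)" by (rule bdd_aboveI2)
    then show ?thesis
      using cSUP_mult_left[OF F_nonempty, of _ "2 * L"] L_pos by (simp add: score_def cum_loss_def)
  qed
  then have "relaxation loss L T F [] =
      measure_pmf.expectation (signs_pmf 0 T) (\<lambda>\<epsilon>. 2 * L * (SUP f\<in>F. \<Sum>t = 1..T. \<epsilon> t * f t))"
    unfolding relaxation_eq_score list.size(3) by (intro integral_cong_AE) (auto simp: AE_measure_pmf_iff)
  then show ?thesis by simp
qed

lemma expected_regret_le:
  assumes \<nu>: "\<And>h. set_pmf (\<nu> h) \<subseteq> {-1..1}"
  shows "measure_pmf.expectation (play_pmf (random_playout loss L T F) \<nu> T) (regret loss F)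
    \<le> relaxation loss L T F []"
proof -
  \<comment> \<open>Only the sum is uniformly bounded: the loss is arbitrary in the outcome.\<close>
  define \<Phi> where "\<Phi> h = (\<Sum>(a, y)\<leftarrow>h. loss a y) + relaxation loss L T F (map snd h)" for h
  have ys: "set (map snd h) \<subseteq> {-1..1}" if "set h \<subseteq> {-1..1} \<times> {-1..1}" for h :: "(real \<times> real) list"
    using that by auto
  have bdd: "\<bar>\<Phi> h\<bar> \<le> 6 * L * T" if h: "set h \<subseteq> {-1..1} \<times> {-1..1}" "length h \<le> T" for h
  proof -
    \<comment> \<open>The loss of the reference expert \<open>g\<close> cancels between the two
      estimates below; the 6 is 2 for the learner against \<open>g\<close> plus 4 for the
      relaxation.\<close>
    obtain g where g: "g \<in> F" using F_nonempty by blast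
    have "2 * L * length h \<le> 2 * L * T" using h(2) L_pos by simp
    with abs_loss_minus_cum_loss_le[OF h g] abs_relaxation_add_cum_loss_le[OF ys[OF h(1)] _ g] h(2)
    show ?thesis unfolding \<Phi>_def by simp
  qed
  have step: "measure_pmf.expectation (random_playout loss L T F (map snd h)) (\<lambda>a. \<Phi> (h @ [(a, y)])) \<le> \<Phi> h"
    if h: "set h \<subseteq> {-1..1} \<times> {-1..1}" "length h < T" and y: "y \<in> {-1..1}" for h y
  proof -
    note int = integrable_measure_pmf_finite[OF finite_set_random_playout]
    show ?thesis
      using relaxation_step[OF ys[OF h(1)] _ y] h(2)
      by (simp add: \<Phi>_def Bochner_Integration.integral_add[OF int int])
  qed
  have "regret loss F h = \<Phi> h" if "h \<in> set_pmf (play_pmf (random_playout loss L T F) \<nu> T)" for h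
  proof -
    have "set h \<subseteq> {-1..1} \<times> {-1..1} \<and> length h = T"
      using set_play_pmf[where \<nu> = \<nu>, OF valid_random_playout \<nu> order_refl that] .
    then show ?thesis
      unfolding regret_def \<Phi>_def by (simp add: relaxation_final)
  qed
  then have "measure_pmf.expectation (play_pmf (random_playout loss L T F) \<nu> T) (regret loss F) =
      measure_pmf.expectation (play_pmf (random_playout loss L T F) \<nu> T) \<Phi>"
    by (intro integral_cong_AE) (auto simp: AE_measure_pmf_iff)
  also have "\<dots> \<le> \<Phi> []"
    by (rule expectation_play_pmf_le[where \<nu> = \<nu>, OF valid_random_playout \<nu> bdd step order_refl])
  finally show ?thesis by (simp add: \<Phi>_def)
qed

end

theorem lemma20:
  fixes T :: nat and F :: "(nat \<Rightarrow> real) set"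
    and loss :: "real \<Rightarrow> real \<Rightarrow> real" and L :: real
  assumes "F \<noteq> {}" and "F \<subseteq> {1..T} \<rightarrow>\<^sub>E {-1..1}"
    and "L > 0"
    and "\<And>y. y \<in> {-1..1} \<Longrightarrow> convex_on {-1..1} (\<lambda>a. loss a y)"
    and "\<And>y. y \<in> {-1..1} \<Longrightarrow> L-lipschitz_on {-1..1} (\<lambda>a. loss a y)"
  shows "valid_learner T (random_playout loss L T F)
    \<and> admissible T F loss (relaxation loss L T F) (random_playout loss L T F)
    \<and> (\<forall>\<nu>::nature. (\<forall>h. set_pmf (\<nu> h) \<subseteq> {-1..1}) \<longrightarrow>
         measure_pmf.expectation (play_pmf (random_playout loss L T F) \<nu> T) (regret loss F)
           \<le> 2 * L * measure_pmf.expectation (signs_pmf 0 T)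
                        (\<lambda>\<epsilon>. SUP f\<in>F. \<Sum>t = 1..T. \<epsilon> t * f t))"
proof -
  interpret static_experts T F loss L
    by unfold_locales (use assms in auto)
  show ?thesis
    using valid_random_playout admissible_relaxation expected_regret_le
    unfolding relaxation_Nil by blast
qed

end
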